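(* Let $L,R\ge0$ be integers with $4\le L-R\le 7$. Then the semi-discretized hybrid-variable (HV) method for $u_t+u_x=0$ built from the optimally accurate discrete differential operator with stencil $(L,R)$ is unstable.
   Context: Uniform periodic grid $x_j=jh$, $h>0$, for the advection equation $u_t+u_x=0$. For a function $u$ write $u_j=u(x_j)$ (nodal values) and $\overline{u}_{j+1/2}=\frac1h\int_{x_j}^{x_{j+1}}u(x)\,dx$ (cell averages). Stencil. A pair $(L,R)$ of non-negative integers determines $l'=\lfloor L/2\rfloor$, $l=L-l'$, $r'=\lfloor R/2\rfloor$, $r=R-r'$. A discrete differential operator (DDO) with this stencil is $$[\mathcal{D}_xu]_j=\frac1h\sum_{k=-l}^{r-1}\alpha_k\overline{u}_{j+k+1/2}+\frac1h\sum_{k=-l'}^{r'}\beta_k u_{j+k},$$ with real constants $\alpha_k,\beta_k$. It is $p$-th order accurate if for all sufficiently smooth $u$ one has $[\mathcal{D}_xu]_j=u_x(x_j)+c_p\,u^{(p+1)}(x_j)h^p+O(h^{p+1})$ for some constant $c_p\neq0$. For each stencil there is a unique DDO of the optimal order $p=l+r+l'+r'=L+R$ (known). Its nodal coefficients are known to be $$\beta_0=2(\zeta_0^{l,r}+\zeta_0^{l',r'}),\qquad \beta_\nu=-\frac{2}{\nu}C^{l,r}_\nu C^{l',r'}_\nu\quad(-l'\le\nu\le r',\ \nu\ne0),$$ where $C^{m,n}_k=\frac{m!\,n!}{(m+k)!\,(n-k)!}$, $\zeta^{m,n}_k=H_{m+k}-H_{n-k}$, and $H_k=1+\frac12+\cdots+\frac1k$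 is the $k$-th harmonic number ($H_0=0$). HV method. The semi-discretized HV method with stencil $(L,R)$ is the ODE system $\overline{u}_{j+1/2}'+\frac1h(u_{j+1}-u_j)=0$, $u_j'+[\mathcal{D}_xu]_j=0$, where $[\mathcal{D}_x]$ is the optimally accurate DDO. Stability. Put $G(\theta)=\sum_{k=-l}^{r-1}\alpha_ke^{ik\theta}$, $H(\theta)=\sum_{k=-l'}^{r'}\beta_ke^{ik\theta}$, $F(\theta)=(e^{i\theta}-1)G(\theta)$, and $$\mathcal{S}'=\{\lambda\in\mathbb{C}:\ \lambda^2-H(\theta)\lambda-F(\theta)=0\ \text{for some}\ 0<\theta<2\pi\}.$$ (By Fourier analysis the eigenvalues of the ODE system are, up to the factor $1/h$, of the form $-\lambda$ with $\lambda$ such a root.) For $L>R$, the method is called stable if $\mathcal{S}'\subseteq\mathbb{C}^+=\{z\in\mathbb{C}:\mathrm{Re}\,z>0\}$, and unstable otherwise. *)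

theory Defs
  imports "HOL-Analysis.Analysis"
begin

subsection \<open>Grid functions\<close>

definition grid_pt :: "real \<Rightarrow> int \<Rightarrow> real" where
  "grid_pt h j = of_int j * h"

definition nodal :: "real \<Rightarrow> (real \<Rightarrow> real) \<Rightarrow> int \<Rightarrow> real" where
  "nodal h u j = u (grid_pt h j)"

text \<open>\<open>cell_avg h u j\<close> is the average over the cell to the right of node \<open>j\<close>, whose
  conventional index is \<open>j + 1/2\<close>.\<close>

definition cell_avg :: "real \<Rightarrow> (real \<Rightarrow> real) \<Rightarrow> int \<Rightarrow> real" where
  "cell_avg h u j = (1 / h) * integral {grid_pt h j..grid_pt h (j + 1)} u"

subsection \<open>Stencils and discrete differential operators\<close>

definition lp :: "nat \<Rightarrow> nat" where "lp L = L div 2"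
definition lc :: "nat \<Rightarrow> nat" where "lc L = L - lp L"
definition rp :: "nat \<Rightarrow> nat" where "rp R = R div 2"
definition rc :: "nat \<Rightarrow> nat" where "rc R = R - rp R"

definition cell_stencil :: "nat \<Rightarrow> nat \<Rightarrow> int set" where
  "cell_stencil L R = {- int (lc L)..int (rc R) - 1}"

definition node_stencil :: "nat \<Rightarrow> nat \<Rightarrow> int set" where
  "node_stencil L R = {- int (lp L)..int (rp R)}"

text \<open>A DDO is given by its coefficients \<open>\<alpha>\<close> and \<open>\<beta>\<close>; their values outside the two
  stencils are never used.\<close>

definition DDO ::
  "nat \<Rightarrow> nat \<Rightarrow> (int \<Rightarrow> real) \<Rightarrow> (int \<Rightarrow> real) \<Rightarrow> real \<Rightarrow> (real \<Rightarrow> real) \<Rightarrow> int \<Rightarrow> real" where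
  "DDO L R \<alpha> \<beta> h u j =
     (1 / h) * (\<Sum>k\<in>cell_stencil L R. \<alpha> k * cell_avg h u (j + k)) +
     (1 / h) * (\<Sum>k\<in>node_stencil L R. \<beta> k * nodal h u (j + k))"

text \<open>\<open>C_diff N u\<close>: \<open>u\<close> is \<open>N\<close> times continuously differentiable on the real line.\<close>

definition C_diff :: "nat \<Rightarrow> (real \<Rightarrow> real) \<Rightarrow> bool" where
  "C_diff N u \<longleftrightarrow>
     (\<forall>m<N. (deriv ^^ m) u differentiable_on UNIV) \<and> continuous_on UNIV ((deriv ^^ N) u)"

text \<open>The remainder \<open>O(h^(p+1))\<close> is understood as \<open>h\<close> tends to \<open>0\<close> from above, for fixed \<open>u\<close>,
  uniformly over the grid points in any bounded interval. The leading error constant \<open>c\<close>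
  depends on the operator only.\<close>

definition order_accurate ::
  "nat \<Rightarrow> nat \<Rightarrow> (int \<Rightarrow> real) \<Rightarrow> (int \<Rightarrow> real) \<Rightarrow> nat \<Rightarrow> bool" where
  "order_accurate L R \<alpha> \<beta> p \<longleftrightarrow>
     (\<exists>c::real. c \<noteq> 0 \<and> (\<exists>N. \<forall>u. C_diff N u \<longrightarrow>
        (\<forall>a b. \<exists>K. \<exists>h0>0. \<forall>h j. 0 < h \<longrightarrow> h < h0 \<longrightarrow> grid_pt h j \<in> {a..b} \<longrightarrow>
           \<bar>DDO L R \<alpha> \<beta> h u j
              - (deriv u (grid_pt h j) + c * (deriv ^^ (p + 1)) u (grid_pt h j) * h ^ p)\<bar>
             \<le> K * h ^ (p + 1))))"

text \<open>The optimal order for the stencil \<open>(L, R)\<close> is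
  \<open>lc L + rc R + lp L + rp R = L + R\<close>; this order determines the coefficients on the stencils
  uniquely.\<close>

definition optimal_DDO :: "nat \<Rightarrow> nat \<Rightarrow> (int \<Rightarrow> real) \<Rightarrow> (int \<Rightarrow> real) \<Rightarrow> bool" where
  "optimal_DDO L R \<alpha> \<beta> \<longleftrightarrow> order_accurate L R \<alpha> \<beta> (L + R)"

subsection \<open>Stability of the semi-discretized HV method\<close>

definition symbol_G :: "nat \<Rightarrow> nat \<Rightarrow> (int \<Rightarrow> real) \<Rightarrow> real \<Rightarrow> complex" where
  "symbol_G L R \<alpha> \<theta> =
     (\<Sum>k\<in>cell_stencil L R. complex_of_real (\<alpha> k) * exp (\<i> * of_int k * complex_of_real \<theta>))"

definition symbol_H :: "nat \<Rightarrow> nat \<Rightarrow> (int \<Rightarrow> real) \<Rightarrow> real \<Rightarrow> complex" where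
  "symbol_H L R \<beta> \<theta> =
     (\<Sum>k\<in>node_stencil L R. complex_of_real (\<beta> k) * exp (\<i> * of_int k * complex_of_real \<theta>))"

definition symbol_F :: "nat \<Rightarrow> nat \<Rightarrow> (int \<Rightarrow> real) \<Rightarrow> real \<Rightarrow> complex" where
  "symbol_F L R \<alpha> \<theta> = (exp (\<i> * complex_of_real \<theta>) - 1) * symbol_G L R \<alpha> \<theta>"

text \<open>Up to the factor \<open>-1/h\<close>, \<open>HV_spectrum\<close> consists of the eigenvalues (for nonconstant Fourier
  modes) of the system formed by \<open>d/dt cell_avg\<^sub>j + (1/h) (nodal\<^sub>j\<^sub>+\<^sub>1 - nodal\<^sub>j) = 0\<close> and
  \<open>d/dt nodal\<^sub>j + DDO\<^sub>j = 0\<close>.\<close>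

definition HV_spectrum :: "nat \<Rightarrow> nat \<Rightarrow> (int \<Rightarrow> real) \<Rightarrow> (int \<Rightarrow> real) \<Rightarrow> complex set" where
  "HV_spectrum L R \<alpha> \<beta> =
     {z. \<exists>\<theta>. 0 < \<theta> \<and> \<theta> < 2 * pi \<and> z\<^sup>2 - symbol_H L R \<beta> \<theta> * z - symbol_F L R \<alpha> \<theta> = 0}"

text \<open>This is the stability criterion for \<open>L > R\<close>.\<close>

definition HV_stable :: "nat \<Rightarrow> nat \<Rightarrow> (int \<Rightarrow> real) \<Rightarrow> (int \<Rightarrow> real) \<Rightarrow> bool" where
  "HV_stable L R \<alpha> \<beta> \<longleftrightarrow> HV_spectrum L R \<alpha> \<beta> \<subseteq> {z. Re z > 0}"

end

theory Submission
  imports Defs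
begin

text \<open>If the method were stable, the sum of the two roots at every \<open>\<theta>\<close>, which is the nodal
  symbol \<open>H(\<theta>)\<close>, would have positive real part. At \<open>\<theta> = \<pi>\<close> this fails: \<open>H(\<pi>)\<close> is the real number
  \<open>\<Sum> (-1)\<^sup>\<nu> \<beta>\<^sub>\<nu>\<close>, and it is nonpositive for \<open>4 \<le> L - R \<le> 7\<close>. The nodal coefficients come from testing
  the exactness of the operator on antiderivatives that vanish on all cell boundaries, so that the
  coefficients \<open>\<alpha>\<close> drop out. The alternating sum vanishes for symmetric stencils, and changing one of
  the four stencil widths by one changes it by an alternating Vandermonde sum, which has a closed form
  when the two pairs of widths have totals that differ by one. Each of the eight cases (four
  differences, two parities) is at most seven such steps away from a symmetric stencil.\<close>

subsection \<open>Exactness on polynomials\<close>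

lemma deriv_poly: "deriv (poly p) = poly (pderiv p)" for p :: "real poly"
  by (intro ext DERIV_imp_deriv poly_DERIV)

lemma funpow_deriv_poly: "(deriv ^^ m) (poly p) = poly ((pderiv ^^ m) p)" for p :: "real poly"
  by (induction m) (simp_all add: deriv_poly)

text \<open>Polynomials are admissible test functions whatever smoothness \<open>N\<close> the
  definition of the order demands.\<close>

lemma C_diff_poly: "C_diff N (poly p)"
proof -
  have "poly q differentiable_on UNIV" for q :: "real poly"
    using poly_differentiable by (simp add: differentiable_on_def)
  moreover have "continuous_on UNIV (poly q)" for q :: "real poly"
    by (rule continuous_on_poly) (rule continuous_on_id)
  ultimately show ?thesis
    by (simp add: C_diff_def funpow_deriv_poly)
qed

lemma funpow_pderiv_eq_0: "degree q < n \<Longrightarrow> (pderiv ^^ n) q = 0" for q :: "real poly"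
proof (induction n arbitrary: q)
  case (Suc n)
  show ?case
  proof (cases "degree q = 0")
    case True
    then have "pderiv q = 0" by (simp add: pderiv_eq_0_iff)
    moreover have "(pderiv ^^ n) 0 = (0::real poly)" by (induction n) auto
    ultimately show ?thesis by (simp add: funpow_Suc_right del: funpow.simps)
  next
    case False
    then have "degree (pderiv q) < n" using Suc.prems by (simp add: degree_pderiv)
    then show ?thesis using Suc.IH by (simp add: funpow_Suc_right del: funpow.simps)
  qed
qed simp

lemma cell_avg_power:
  assumes "h > 0"
  shows "cell_avg h (\<lambda>x. x ^ m) j
    = h ^ m * ((of_int (j + 1) ^ Suc m - of_int j ^ Suc m) / real (Suc m))"
proof -
  let ?F = "\<lambda>x::real. x ^ Suc m / real (Suc m)"
  have le: "grid_pt h j \<le> grid_pt h (j + 1)"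
    using assms by (simp add: grid_pt_def algebra_simps)
  have d: "(?F has_vector_derivative x ^ m) (at x within S)" for x S
    using DERIV_cdivide[OF DERIV_pow[of "Suc m" x S], of "real (Suc m)"]
    by (simp add: has_real_derivative_iff_has_vector_derivative[symmetric] del: of_nat_Suc power_Suc)
  have "((\<lambda>x. x ^ m) has_integral ?F (grid_pt h (j + 1)) - ?F (grid_pt h j))
      {grid_pt h j..grid_pt h (j + 1)}"
    using fundamental_theorem_of_calculus[OF le d] .
  then have "integral {grid_pt h j..grid_pt h (j + 1)} (\<lambda>x. x ^ m)
      = ?F (grid_pt h (j + 1)) - ?F (grid_pt h j)"
    by (rule integral_unique)
  moreover have "grid_pt h i ^ Suc m = h * (h ^ m * of_int i ^ Suc m)" for i
    by (simp add: grid_pt_def power_mult_distrib)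
  ultimately have "integral {grid_pt h j..grid_pt h (j + 1)} (\<lambda>x. x ^ m)
      = h * (h ^ m * ((of_int (j + 1) ^ Suc m - of_int j ^ Suc m) / real (Suc m)))"
    by (simp only: right_diff_distrib diff_divide_distrib times_divide_eq_right)
  then show ?thesis
    using assms by (simp add: cell_avg_def del: of_nat_Suc power_Suc)
qed

text \<open>Homogeneity: at the grid point 0 the operator applied to x^m is h^m / h times a number X
  independent of h. The error term with the (p+1)-st derivative vanishes because m \<le> p, so the
  estimate bounds |X - d| by a positive power of h, and h tends to 0.\<close>

lemma order_accurate_power:
  assumes "order_accurate L R \<alpha> \<beta> p" and "m \<le> p"
  shows "(\<Sum>k\<in>cell_stencil L R. \<alpha> k * ((of_int (k + 1) ^ Suc m - of_int k ^ Suc m) / real (Suc m)))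
    + (\<Sum>k\<in>node_stencil L R. \<beta> k * of_int k ^ m) = (if m = 1 then 1 else 0)"
    (is "?X = ?d")
proof -
  define X d where "X = ?X" and "d = (?d :: real)"
  let ?u = "\<lambda>x::real. x ^ m"
  have u: "?u = poly (monom 1 m)" by (auto simp: poly_monom)
  obtain c N where *: "\<And>u a b. C_diff N u \<Longrightarrow> \<exists>K. \<exists>h0>0. \<forall>h j. 0 < h \<longrightarrow> h < h0 \<longrightarrow>
      grid_pt h j \<in> {a..b} \<longrightarrow>
      \<bar>DDO L R \<alpha> \<beta> h u j - (deriv u (grid_pt h j) + c * (deriv ^^ (p + 1)) u (grid_pt h j) * h ^ p)\<bar>
        \<le> K * h ^ (p + 1)"
    using assms(1) unfolding order_accurate_def by metis
  have "C_diff N ?u" unfolding u by (rule C_diff_poly)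
  \<comment> \<open>The interval {0..0} contains just the node j = 0.\<close>
  from *[OF this, of 0 0] obtain K h0 where "h0 > 0"
    and K: "\<And>h j. 0 < h \<Longrightarrow> h < h0 \<Longrightarrow> grid_pt h j \<in> {0..0} \<Longrightarrow>
      \<bar>DDO L R \<alpha> \<beta> h ?u j - (deriv ?u (grid_pt h j) + c * (deriv ^^ (p + 1)) ?u (grid_pt h j) * h ^ p)\<bar>
        \<le> K * h ^ (p + 1)" by blast
  have d0: "deriv ?u 0 = d"
    unfolding u deriv_poly d_def by (auto simp: pderiv_monom poly_monom power_0_left)
  have dp: "(deriv ^^ (p + 1)) ?u 0 = 0"
    unfolding u funpow_deriv_poly using assms(2) by (subst funpow_pderiv_eq_0) (auto simp: degree_monom_eq)
  have bound: "\<bar>X - d\<bar> \<le> K * h ^ (p + 2 - m)" if h: "0 < h" "h < h0" for h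
  proof -
    have avg: "(\<Sum>k\<in>cell_stencil L R. \<alpha> k * cell_avg h ?u (0 + k)) = h ^ m *
      (\<Sum>k\<in>cell_stencil L R. \<alpha> k * ((of_int (k + 1) ^ Suc m - of_int k ^ Suc m) / real (Suc m)))"
      unfolding cell_avg_power[OF h(1)] sum_distrib_left by (intro sum.cong) simp_all
    have nod: "(\<Sum>k\<in>node_stencil L R. \<beta> k * nodal h ?u (0 + k))
      = h ^ m * (\<Sum>k\<in>node_stencil L R. \<beta> k * of_int k ^ m)"
      unfolding sum_distrib_left
      by (intro sum.cong) (simp_all add: nodal_def grid_pt_def power_mult_distrib)
    have D: "DDO L R \<alpha> \<beta> h ?u 0 = h ^ m / h * X"
      unfolding DDO_def avg nod X_def
      by (simp only: distrib_left mult.assoc[symmetric] times_divide_eq_left mult_1_left)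
    \<comment> \<open>d is nonzero only for m = 1, where the factor is 1; hence X and d carry the
      same power of h.\<close>
    have "h ^ m / h * d = d"
      using h by (simp add: d_def)
    then have "h ^ m / h * (X - d) = DDO L R \<alpha> \<beta> h ?u 0 - d"
      unfolding D right_diff_distrib by simp
    moreover have "\<bar>DDO L R \<alpha> \<beta> h ?u 0 - d\<bar> \<le> K * h ^ (p + 1)"
      using K[OF h, of 0] d0 dp by (simp add: grid_pt_def)
    ultimately have "\<bar>h ^ m / h * (X - d)\<bar> \<le> K * h ^ (p + 1)" by simp
    then have "h ^ m / h * \<bar>X - d\<bar> \<le> K * h ^ (p + 1)"
      using h by (simp add: abs_mult)
    also have "\<dots> = h ^ m / h * (K * h ^ (p + 2 - m))"
    proof -
      have "p + 2 = m + (p + 2 - m)" using assms(2) by simp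
      then have "h ^ (p + 2) = h ^ m * h ^ (p + 2 - m)" by (metis power_add)
      then show ?thesis using h by (simp add: field_simps)
    qed
    finally show ?thesis using h by (subst (asm) mult_le_cancel_left_pos) auto
  qed
  have "((\<lambda>h. K * h ^ (p + 2 - m)) \<longlongrightarrow> K * 0 ^ (p + 2 - m)) (at_right 0)"
    by (intro tendsto_intros)
  moreover have "K * 0 ^ (p + 2 - m) = 0"
    using assms(2) by (simp add: power_0_left)
  ultimately have "((\<lambda>h. K * h ^ (p + 2 - m)) \<longlongrightarrow> 0) (at_right 0)"
    by (simp only:)
  moreover have "\<forall>\<^sub>F h in at_right 0. \<bar>X - d\<bar> \<le> K * h ^ (p + 2 - m)"
    using bound \<open>h0 > 0\<close> unfolding eventually_at_right_field by blast
  ultimately have "\<bar>X - d\<bar> \<le> 0"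
    by (intro tendsto_lowerbound) auto
  then have "X = d" by simp
  then show ?thesis unfolding X_def d_def .
qed

text \<open>Exactness for u = U', written with the antiderivative U so that cell averages become
  differences of U. Passing to U raises the admissible degree from p to p + 1. By linearity
  monomials suffice: constants contribute nothing, and x^(m+1) gives m + 1 times the condition for
  x^m.\<close>

lemma order_accurate_exact:
  assumes "order_accurate L R \<alpha> \<beta> p" and "degree U \<le> p + 1"
  shows "(\<Sum>k\<in>cell_stencil L R. \<alpha> k * (poly U (of_int (k + 1)) - poly U (of_int k)))
    + (\<Sum>k\<in>node_stencil L R. \<beta> k * poly (pderiv U) (of_int k)) = poly (pderiv (pderiv U)) 0"
proof -
  define \<Lambda> where "\<Lambda> U = (\<Sum>k\<in>cell_stencil L R. \<alpha> k * (poly U (of_int (k + 1)) - poly U (of_int k)))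
    + (\<Sum>k\<in>node_stencil L R. \<beta> k * poly (pderiv U) (of_int k)) - poly (pderiv (pderiv U)) 0" for U
  have add: "\<Lambda> (U + V) = \<Lambda> U + \<Lambda> V" for U V
    by (simp add: \<Lambda>_def pderiv_add distrib_left right_diff_distrib sum.distrib sum_subtractf)
  have smult: "\<Lambda> (smult a U) = a * \<Lambda> U" for a U
    by (simp add: \<Lambda>_def pderiv_smult distrib_left right_diff_distrib sum_distrib_left mult.left_commute
        sum_subtractf)
  have sum: "\<Lambda> (sum f I) = (\<Sum>i\<in>I. \<Lambda> (f i))" for f and I :: "nat set"
    by (induction I rule: infinite_finite_induct) (simp_all add: add, simp_all add: \<Lambda>_def)
  have monom: "\<Lambda> (monom 1 i) = 0" if "i \<le> p + 1" for i
  proof (cases i)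
    case 0
    then show ?thesis by (simp add: \<Lambda>_def monom_0 pderiv_pCons)
  next
    case (Suc m)
    then have "m \<le> p" using that by simp
    have "poly (pderiv (pderiv (monom 1 i))) 0 = real (Suc m) * (if m = 1 then 1 else 0)"
      by (auto simp: Suc pderiv_monom poly_monom power_0_left)
    also have "\<dots> = (\<Sum>k\<in>cell_stencil L R. real (Suc m) *
          (\<alpha> k * ((of_int (k + 1) ^ Suc m - of_int k ^ Suc m) / real (Suc m))))
        + (\<Sum>k\<in>node_stencil L R. real (Suc m) * (\<beta> k * of_int k ^ m))"
      unfolding order_accurate_power[OF assms(1) \<open>m \<le> p\<close>, symmetric]
      by (simp only: distrib_left sum_distrib_left)
    also have "\<dots> = (\<Sum>k\<in>cell_stencil L R. \<alpha> k * (poly (monom 1 i) (of_int (k + 1)) - poly (monom 1 i) (of_int k)))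
        + (\<Sum>k\<in>node_stencil L R. \<beta> k * poly (pderiv (monom 1 i)) (of_int k))"
      by (intro arg_cong2[where f = "(+)"] sum.cong)
        (simp_all add: Suc pderiv_monom poly_monom del: of_nat_Suc power_Suc of_int_add)
    finally show ?thesis by (simp only: \<Lambda>_def)
  qed
  have "\<Lambda> U = \<Lambda> (\<Sum>i\<le>p + 1. smult (coeff U i) (monom 1 i))"
    using poly_as_sum_of_monoms'[OF assms(2)] by (simp add: smult_monom)
  also have "\<dots> = 0" unfolding sum smult using monom by simp
  finally show ?thesis by (simp add: \<Lambda>_def)
qed

subsection \<open>The nodal coefficients\<close>

definition node_poly :: "int set \<Rightarrow> real poly" where
  "node_poly S = (\<Prod>k\<in>S. [:- of_int k, 1:])"

lemma poly_node_poly: "poly (node_poly S) x = (\<Prod>k\<in>S. x - of_int k)"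
  by (simp add: node_poly_def poly_prod)

lemma node_poly_remove:
  "finite S \<Longrightarrow> k \<in> S \<Longrightarrow> node_poly S = [:- of_int k, 1:] * node_poly (S - {k})"
  by (simp add: node_poly_def prod.remove)

lemma poly_node_poly_eq_0: "finite S \<Longrightarrow> k \<in> S \<Longrightarrow> poly (node_poly S) (of_int k) = 0"
  by (simp add: node_poly_remove)

lemma degree_node_poly: "finite S \<Longrightarrow> degree (node_poly S) = card S"
  by (simp add: node_poly_def degree_prod_sum_eq)

lemma poly_pderiv_node_poly:
  assumes "finite S" "k \<in> S"
  shows "poly (pderiv (node_poly S)) (of_int k) = poly (node_poly (S - {k})) (of_int k)"
  unfolding node_poly_remove[OF assms] pderiv_mult by (simp add: pderiv_pCons)

lemma poly_pderiv2_node_poly: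
  assumes "finite S" "k \<in> S"
  shows "poly (pderiv (pderiv (node_poly S))) (of_int k) = 2 * poly (pderiv (node_poly (S - {k}))) (of_int k)"
  unfolding node_poly_remove[OF assms] pderiv_mult pderiv_add by (simp add: pderiv_pCons)

text \<open>The logarithmic derivative of the product at 0. On a punctured interval the sum of
  reciprocals is a difference of harmonic numbers, which is how these enter \<beta> at node
  0.\<close>

lemma poly_pderiv_node_poly_0:
  assumes "finite S" "0 \<notin> S"
  shows "poly (pderiv (node_poly S)) 0 = - poly (node_poly S) 0 * (\<Sum>k\<in>S. 1 / of_int k)"
  using assms
proof (induction S rule: finite_induct)
  case empty
  then show ?case by (simp add: node_poly_def)
next
  case (insert k S)
  have *: "node_poly (insert k S) = [:- of_int k, 1:] * node_poly S"
    using insert by (simp add: node_poly_def)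
  have "poly (pderiv (node_poly (insert k S))) 0
      = poly (node_poly S) 0 - of_int k * poly (pderiv (node_poly S)) 0"
    unfolding * pderiv_mult by (simp add: pderiv_pCons)
  moreover have "poly (node_poly (insert k S)) 0 = - of_int k * poly (node_poly S) 0"
    unfolding * by simp
  ultimately show ?case
    using insert by (simp add: field_simps)
qed

lemma atLeastAtMost_remove_int:
  "{- int l..int r} - {\<nu>} = {- int l..\<nu> - 1} \<union> {\<nu> + 1..int r}"
  if "- int l \<le> \<nu>" "\<nu> \<le> int r"
  using that by auto

text \<open>The roots left of \<nu> contribute one factorial; those right of \<nu> contribute the
  other, with one sign per root.\<close>

lemma poly_node_poly_remove:
  assumes "- int l \<le> \<nu>" "\<nu> \<le> int r"
  shows "poly (node_poly ({- int l..int r} - {\<nu>})) (of_int \<nu>)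
    = (- 1) ^ nat (int r - \<nu>) * fact (nat (int l + \<nu>)) * fact (nat (int r - \<nu>))"
proof -
  have *: "(\<Prod>k\<in>{- int l..\<nu> - 1}. of_int \<nu> - of_int k :: real) = fact (nat (int l + \<nu>))"
    unfolding fact_prod of_nat_prod
    by (rule prod.reindex_bij_witness[of _ "\<lambda>i. \<nu> - int i" "\<lambda>k. nat (\<nu> - k)"]) auto
  have "(\<Prod>k\<in>{\<nu> + 1..int r}. of_int \<nu> - of_int k :: real)
      = (\<Prod>i\<in>{1..nat (int r - \<nu>)}. - 1 * real i)"
    by (rule prod.reindex_bij_witness[of _ "\<lambda>i. \<nu> + int i" "\<lambda>k. nat (k - \<nu>)"]) auto
  also have "\<dots> = (- 1) ^ nat (int r - \<nu>) * fact (nat (int r - \<nu>))"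
    unfolding fact_prod of_nat_prod prod.distrib by simp
  finally have **: "(\<Prod>k\<in>{\<nu> + 1..int r}. of_int \<nu> - of_int k :: real)
      = (- 1) ^ nat (int r - \<nu>) * fact (nat (int r - \<nu>))" .
  have "(\<Prod>k\<in>{- int l..int r} - {\<nu>}. of_int \<nu> - of_int k :: real)
      = (\<Prod>k\<in>{- int l..\<nu> - 1}. of_int \<nu> - of_int k) * (\<Prod>k\<in>{\<nu> + 1..int r}. of_int \<nu> - of_int k)"
    unfolding atLeastAtMost_remove_int[OF assms] by (rule prod.union_disjoint) auto
  then show ?thesis
    unfolding poly_node_poly * ** by simp
qed

lemma sum_inverse_int_interval:
  "(\<Sum>k\<in>{- int l..int r} - {0}. 1 / real_of_int k) = harm r - harm l"
proof -
  have "(\<Sum>k\<in>{- int l..- 1}. 1 / real_of_int k) = (\<Sum>i\<in>{1..l}. - inverse (real i))"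
    by (rule sum.reindex_bij_witness[of _ "\<lambda>i. - int i" "\<lambda>k. nat (- k)"])
      (auto simp: field_simps)
  moreover have "(\<Sum>k\<in>{1..int r}. 1 / real_of_int k) = (\<Sum>i\<in>{1..r}. inverse (real i))"
    by (rule sum.reindex_bij_witness[of _ "\<lambda>i. int i" nat]) (auto simp: field_simps)
  moreover have "(\<Sum>k\<in>{- int l..int r} - {0}. 1 / real_of_int k)
      = (\<Sum>k\<in>{- int l..- 1}. 1 / real_of_int k) + (\<Sum>k\<in>{1..int r}. 1 / real_of_int k)"
    using atLeastAtMost_remove_int[of l 0 r] by (simp add: sum.union_disjoint)
  ultimately show ?thesis by (simp add: harm_def sum_negf)
qed

text \<open>Extension by 0 corresponds to reading 1/k! as 0 for negative k, so sums may run over any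
  interval containing the support.\<close>

definition C_coeff :: "nat \<Rightarrow> nat \<Rightarrow> int \<Rightarrow> real" where
  "C_coeff m n k = (if - int m \<le> k \<and> k \<le> int n
     then fact m * fact n / (fact (nat (int m + k)) * fact (nat (int n - k))) else 0)"

text \<open>The sign (-1)^k, defined by parity because k may be negative.\<close>

definition alt :: "int \<Rightarrow> real" where
  "alt k = (if even k then 1 else - 1)"

lemma alt_add: "alt (i + j) = alt i * alt j" and alt_minus [simp]: "alt (- i) = alt i"
  and alt_mult_self [simp]: "alt i * alt i = 1" and alt_0 [simp]: "alt 0 = 1"
  by (auto simp: alt_def)

lemma alt_int: "alt (int n) = (- 1) ^ n"
  by (simp add: alt_def)

lemma minus_one_power_nat: "k \<ge> 0 \<Longrightarrow> (- 1) ^ nat k = alt k"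
  by (metis alt_int nat_0_le)

lemma C_coeff_0 [simp]: "C_coeff m n 0 = 1"
  by (simp add: C_coeff_def)

text \<open>This is where the coefficients C come from: they compare, up to sign, the derivatives of
  one node polynomial at the roots 0 and \<nu>.\<close>

lemma poly_node_poly_remove_ratio:
  assumes "- int l \<le> \<nu>" "\<nu> \<le> int r"
  shows "poly (node_poly ({- int l..int r} - {0})) 0
    = alt \<nu> * C_coeff l r \<nu> * poly (node_poly ({- int l..int r} - {\<nu>})) (of_int \<nu>)"
proof -
  have "poly (node_poly ({- int l..int r} - {0})) 0 = alt (int r) * fact l * fact r"
    using poly_node_poly_remove[of l 0 r] by (simp add: alt_int)
  moreover have "poly (node_poly ({- int l..int r} - {\<nu>})) (of_int \<nu>)
      = alt (int r - \<nu>) * fact (nat (int l + \<nu>)) * fact (nat (int r - \<nu>))"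
    using poly_node_poly_remove[OF assms] assms by (simp add: minus_one_power_nat)
  moreover have "alt \<nu> * alt (int r - \<nu>) = alt (int r)"
    using alt_add[of \<nu> "int r - \<nu>"] by simp
  ultimately show ?thesis
    using assms by (simp add: C_coeff_def field_simps)
qed

lemma poly_node_poly_remove_nz:
  assumes "finite S" shows "poly (node_poly (S - {\<nu>})) (of_int \<nu>) \<noteq> 0"
  using assms by (auto simp: poly_node_poly)

section \<open>Nodal coefficients of the optimal operator\<close>

lemma stencil_split: "lc L + lp L = L" "rc R + rp R = R" "lp L \<le> lc L" "rp R \<le> rc R"
  by (auto simp: lc_def lp_def rc_def rp_def)

text \<open>The test function U has two factors. The first vanishes on all cell boundaries and
  removes every \<alpha>; the second vanishes at all nodes of T except \<nu> and isolates \<beta>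
  \<nu>. The degree of U is L + R + 1, the largest that exactness allows.\<close>

lemma optimal_DDO_node_eq:
  assumes "optimal_DDO L R \<alpha> \<beta>" and \<nu>: "\<nu> \<in> node_stencil L R"
  defines "S \<equiv> {- int (lc L)..int (rc R)}" and "T \<equiv> node_stencil L R"
  shows "\<beta> \<nu> * poly (node_poly (S - {\<nu>})) (of_int \<nu>) * poly (node_poly (T - {\<nu>})) (of_int \<nu>)
    = 2 * poly (pderiv (node_poly (S - {0}))) 0 * poly (node_poly (T - {\<nu>})) 0
      + 2 * poly (node_poly (S - {0})) 0 * poly (pderiv (node_poly (T - {\<nu>}))) 0"
proof -
  define U where "U = node_poly S * node_poly (T - {\<nu>})"
  have fin: "finite S" "finite T" and sub: "T \<subseteq> S" and "0 \<in> S"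
    using stencil_split(3)[of L] stencil_split(4)[of R] by (auto simp: S_def T_def node_stencil_def)
  have "card S = lc L + rc R + 1" "card (T - {\<nu>}) = lp L + rp R"
    using \<nu> by (auto simp: S_def T_def node_stencil_def)
  then have "degree U \<le> L + R + 1"
    using degree_mult_le[of "node_poly S" "node_poly (T - {\<nu>})"] fin stencil_split(1)[of L] stencil_split(2)[of R]
    by (simp add: U_def degree_node_poly)
  then have "(\<Sum>k\<in>cell_stencil L R. \<alpha> k * (poly U (of_int (k + 1)) - poly U (of_int k)))
    + (\<Sum>k\<in>T. \<beta> k * poly (pderiv U) (of_int k)) = poly (pderiv (pderiv U)) 0"
    unfolding T_def by (rule order_accurate_exact[OF assms(1)[unfolded optimal_DDO_def]])
  moreover have "(\<Sum>k\<in>cell_stencil L R. \<alpha> k * (poly U (of_int (k + 1)) - poly U (of_int k))) = 0"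
  proof (intro sum.neutral ballI)
    fix k assume "k \<in> cell_stencil L R"
    then have "k \<in> S" "k + 1 \<in> S" by (auto simp: cell_stencil_def S_def)
    then show "\<alpha> k * (poly U (of_int (k + 1)) - poly U (of_int k)) = 0"
      using poly_node_poly_eq_0[OF fin(1)] by (simp add: U_def del: of_int_add)
  qed
  \<comment> \<open>Every node of T is a root of the first factor, so U' there is the derivative of
    the first factor times the second, which is 0 unless k = \<nu>.\<close>
  moreover have "(\<Sum>k\<in>T. \<beta> k * poly (pderiv U) (of_int k))
      = (\<Sum>k\<in>T. if k = \<nu> then \<beta> \<nu> * poly (node_poly (S - {\<nu>})) (of_int \<nu>) * poly (node_poly (T - {\<nu>})) (of_int \<nu>) else 0)"
  proof (intro sum.cong refl)
    fix k assume k: "k \<in> T"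
    then have "k \<in> S" using sub by blast
    have "poly (node_poly (T - {\<nu>})) (of_int k) = 0" if "k \<noteq> \<nu>"
      using that k fin by (intro poly_node_poly_eq_0) auto
    then show "\<beta> k * poly (pderiv U) (of_int k) = (if k = \<nu> then
        \<beta> \<nu> * poly (node_poly (S - {\<nu>})) (of_int \<nu>) * poly (node_poly (T - {\<nu>})) (of_int \<nu>) else 0)"
      using poly_node_poly_eq_0[OF fin(1) \<open>k \<in> S\<close>] poly_pderiv_node_poly[OF fin(1) \<open>k \<in> S\<close>]
      by (simp add: U_def pderiv_mult)
  qed
  \<comment> \<open>The product rule has only two terms here, since the first factor vanishes at
    0.\<close>
  moreover have "poly (pderiv (pderiv U)) 0
      = poly (pderiv (pderiv (node_poly S))) 0 * poly (node_poly (T - {\<nu>})) 0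
        + 2 * poly (pderiv (node_poly S)) 0 * poly (pderiv (node_poly (T - {\<nu>}))) 0"
    using poly_node_poly_eq_0[OF fin(1) \<open>0 \<in> S\<close>] by (simp add: U_def pderiv_mult pderiv_add)
  ultimately show ?thesis
    using \<nu> fin poly_pderiv_node_poly[OF fin(1) \<open>0 \<in> S\<close>] poly_pderiv2_node_poly[OF fin(1) \<open>0 \<in> S\<close>]
    by (simp add: T_def)
qed

text \<open>For \<nu> \<noteq> 0 the second factor still has the root 0, so only its derivative at 0
  survives; that derivative omits both roots 0 and \<nu>, which produces -1/\<nu>. The signs from
  the two ratios cancel.\<close>

lemma optimal_DDO_node_coeff:
  assumes "optimal_DDO L R \<alpha> \<beta>" and \<nu>: "\<nu> \<in> node_stencil L R" and "\<nu> \<noteq> 0"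
  shows "\<beta> \<nu> = - 2 / of_int \<nu> * C_coeff (lc L) (rc R) \<nu> * C_coeff (lp L) (rp R) \<nu>"
proof -
  define S T where "S = {- int (lc L)..int (rc R)}" and "T = node_stencil L R"
  have fin: "finite S" "finite T"
    by (auto simp: S_def T_def node_stencil_def)
  have 0: "0 \<in> T - {\<nu>}" and bd: "- int (lp L) \<le> \<nu>" "\<nu> \<le> int (rp R)"
    "- int (lc L) \<le> \<nu>" "\<nu> \<le> int (rc R)"
    using assms(2,3) stencil_split(3)[of L] stencil_split(4)[of R] by (auto simp: T_def node_stencil_def)
  define s t where "s = poly (node_poly (S - {\<nu>})) (of_int \<nu>)"
    and "t = poly (node_poly (T - {\<nu>})) (of_int \<nu>)"
  have nz: "s \<noteq> 0" "t \<noteq> 0"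
    using fin by (auto simp: s_def t_def poly_node_poly_remove_nz)
  have S0: "poly (node_poly (S - {0})) 0 = alt \<nu> * C_coeff (lc L) (rc R) \<nu> * s"
    unfolding S_def s_def by (rule poly_node_poly_remove_ratio[OF bd(3,4)])
  have T0: "poly (node_poly (T - {0})) 0 = alt \<nu> * C_coeff (lp L) (rp R) \<nu> * t"
    unfolding T_def node_stencil_def t_def by (rule poly_node_poly_remove_ratio[OF bd(1,2)])
  have "T - {0} - {\<nu>} = T - {\<nu>} - {0}" by blast
  then have "poly (pderiv (node_poly (T - {\<nu>}))) 0 = - poly (node_poly (T - {0})) 0 / of_int \<nu>"
    using poly_pderiv_node_poly[OF _ 0] node_poly_remove[of "T - {0}" \<nu>] fin \<nu> assms(3)
    by (simp add: T_def)
  moreover have "poly (node_poly (T - {\<nu>})) 0 = 0"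
    using poly_node_poly_eq_0[OF _ 0] fin by simp
  ultimately have "\<beta> \<nu> * (s * t) = - 2 / of_int \<nu> * poly (node_poly (S - {0})) 0 * poly (node_poly (T - {0})) 0"
    using optimal_DDO_node_eq[OF assms(1) \<nu>, folded S_def T_def] by (simp add: s_def t_def)
  also have "\<dots> = (- 2 / of_int \<nu> * C_coeff (lc L) (rc R) \<nu> * C_coeff (lp L) (rp R) \<nu>) * (alt \<nu> * alt \<nu>) * (s * t)"
    unfolding S0 T0 by (simp only: mult_ac)
  finally have "\<beta> \<nu> * (s * t) = (- 2 / of_int \<nu> * C_coeff (lc L) (rc R) \<nu> * C_coeff (lp L) (rp R) \<nu>) * (s * t)"
    by (simp only: alt_mult_self mult_1_right)
  then show ?thesis
    by (subst (asm) mult_right_cancel) (use nz in simp_all)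
qed

text \<open>For \<nu> = 0 neither remaining product has the root 0, so both terms of the equation
  are logarithmic derivatives.\<close>

lemma optimal_DDO_node_coeff_0:
  assumes "optimal_DDO L R \<alpha> \<beta>"
  shows "\<beta> 0 = 2 * (harm (lc L) - harm (rc R) + harm (lp L) - harm (rp R))"
proof -
  define S T where "S = {- int (lc L)..int (rc R)}" and "T = node_stencil L R"
  define s t where "s = poly (node_poly (S - {0})) 0" and "t = poly (node_poly (T - {0})) 0"
  have nz: "s \<noteq> 0" "t \<noteq> 0"
    using poly_node_poly_remove_nz[of S 0] poly_node_poly_remove_nz[of T 0]
    by (auto simp: s_def t_def S_def T_def node_stencil_def)
  have S: "poly (pderiv (node_poly (S - {0}))) 0 = s * (harm (lc L) - harm (rc R))"
    using poly_pderiv_node_poly_0[of "S - {0}"]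
    unfolding S_def sum_inverse_int_interval s_def by (simp add: algebra_simps)
  have T: "poly (pderiv (node_poly (T - {0}))) 0 = t * (harm (lp L) - harm (rp R))"
    using poly_pderiv_node_poly_0[of "T - {0}"]
    unfolding T_def node_stencil_def sum_inverse_int_interval t_def by (simp add: algebra_simps)
  have "(0::int) \<in> node_stencil L R" by (simp add: node_stencil_def)
  from optimal_DDO_node_eq[OF assms this, folded S_def T_def]
  have "\<beta> 0 * s * t = 2 * (harm (lc L) - harm (rc R) + harm (lp L) - harm (rp R)) * s * t"
    unfolding S T of_int_0 s_def[symmetric] t_def[symmetric] by (simp add: algebra_simps)
  then show ?thesis using nz by simp
qed

subsection \<open>Alternating sums\<close>

lemma C_coeff_minus: "C_coeff m n (- k) = C_coeff n m k"
  by (auto simp: C_coeff_def mult_ac)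

text \<open>The correction term is proportional to k and thus cancels the 1/k in
  \<open>node_sum\<close>. At k = -(m+1), which only the wider coefficient supports, the factor is
  0.\<close>

lemma C_coeff_Suc: "C_coeff m n k = C_coeff (Suc m) n k * (1 + of_int k / real (Suc m))"
proof -
  consider "k = - int (Suc m)" | "- int m \<le> k" "k \<le> int n" | "k < - int (Suc m) \<or> k > int n"
    by linarith
  then show ?thesis
  proof cases
    case 1
    then have "real_of_int k = - real (Suc m)" by simp
    then have "1 + of_int k / real (Suc m) = 0" by (simp del: of_nat_Suc)
    then show ?thesis using 1 by (simp add: C_coeff_def)
  next
    case 2
    have *: "nat (int (Suc m) + k) = Suc (nat (int m + k))"
      using 2 by linarith
    have "real (Suc (nat (int m + k))) = real (Suc m) + of_int k"
      using 2 by simp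
    then have **: "fact (nat (int (Suc m) + k)) = (real (Suc m) + of_int k) * fact (nat (int m + k))"
      unfolding * fact_Suc by simp
    have "real (Suc m) + of_int k > 0" using 2 by linarith
    then show ?thesis
      using 2 unfolding C_coeff_def ** by (simp add: fact_Suc divide_simps del: of_nat_Suc)
  qed (auto simp: C_coeff_def)
qed

section \<open>Recurrences of the alternating sums in the four widths\<close>

text \<open>The increment of \<open>node_sum\<close> when one width changes by one, up to the
  reciprocal of that width.\<close>

definition alt_sum :: "nat \<Rightarrow> nat \<Rightarrow> nat \<Rightarrow> nat \<Rightarrow> nat \<Rightarrow> real" where
  "alt_sum K l r l' r' = (\<Sum>k\<in>{- int K..int K}. alt k * C_coeff l r k * C_coeff l' r' k)"

text \<open>Up to the factor \<open>-2\<close> this is \<open>\<Sum> (-1)\<^sup>\<nu> \<beta>\<^sub>\<nu>\<close>, the nodal symbol at \<open>\<theta> = \<pi>\<close>. The bound \<open>K\<close> only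
  has to exceed the support of the summand; fixing it keeps the recurrences free of side conditions.\<close>

definition node_sum :: "nat \<Rightarrow> nat \<Rightarrow> nat \<Rightarrow> nat \<Rightarrow> nat \<Rightarrow> real" where
  "node_sum K l r l' r' =
     (\<Sum>k\<in>{- int K..int K} - {0}. alt k * C_coeff l r k * C_coeff l' r' k / of_int k)
       - (harm l - harm r + harm l' - harm r')"

lemma alt_sum_commute: "alt_sum K l r l' r' = alt_sum K l' r' l r"
  by (simp add: alt_sum_def mult_ac)

lemma node_sum_commute: "node_sum K l r l' r' = node_sum K l' r' l r"
  by (simp add: node_sum_def mult_ac)

lemma alt_sum_reflect: "alt_sum K l r l' r' = alt_sum K r l r' l'"
  unfolding alt_sum_def
  by (rule sum.reindex_bij_witness[of _ uminus uminus]) (auto simp: C_coeff_minus)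

lemma node_sum_reflect: "node_sum K l r l' r' = - node_sum K r l r' l'"
proof -
  have "(\<Sum>k\<in>{- int K..int K} - {0}. alt k * C_coeff l r k * C_coeff l' r' k / of_int k)
    = (\<Sum>k\<in>{- int K..int K} - {0}. - (alt k * C_coeff r l k * C_coeff r' l' k / of_int k))"
    by (rule sum.reindex_bij_witness[of _ uminus uminus]) (auto simp: C_coeff_minus)
  then show ?thesis by (simp add: node_sum_def sum_negf)
qed

text \<open>Inserting \<open>C_coeff_Suc\<close> cancels 1/k and leaves an alternating sum without
  its term k = 0. That missing term is 1, and the harmonic number \<open>harm (Suc l)\<close>
  supplies exactly the lacking 1/(l+1).\<close>

lemma node_sum_Suc_left:
  "node_sum K (Suc l) r l' r' = node_sum K l r l' r' - alt_sum K (Suc l) r l' r' / real (Suc l)"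
proof -
  let ?I = "{- int K..int K} - {0}"
  have "(\<Sum>k\<in>?I. alt k * C_coeff l r k * C_coeff l' r' k / of_int k)
      = (\<Sum>k\<in>?I. alt k * C_coeff (Suc l) r k * C_coeff l' r' k / of_int k
          + alt k * C_coeff (Suc l) r k * C_coeff l' r' k / real (Suc l))"
    by (intro sum.cong refl, subst C_coeff_Suc)
      (simp add: divide_simps del: of_nat_Suc, simp add: algebra_simps)
  also have "\<dots> = (\<Sum>k\<in>?I. alt k * C_coeff (Suc l) r k * C_coeff l' r' k / of_int k)
      + (alt_sum K (Suc l) r l' r' - 1) / real (Suc l)"
    unfolding sum.distrib alt_sum_def sum_divide_distrib[symmetric]
    by (subst (2) sum_diff1) auto
  finally show ?thesis
    by (simp add: node_sum_def harm_Suc diff_divide_distrib inverse_eq_divide del: of_nat_Suc)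
qed

text \<open>The reflection k to -k of the previous rule. Read as lowering r + 1 to r, it subtracts a
  sum of the same kind as raising a left width does.\<close>

lemma node_sum_Suc_right:
  "node_sum K l r l' r' = node_sum K l (Suc r) l' r' - alt_sum K l (Suc r) l' r' / real (Suc r)"
  using node_sum_Suc_left[of K r l r' l'] node_sum_reflect[of K l] alt_sum_reflect[of K l]
  by simp

lemma node_sum_Suc_left':
  "node_sum K l r (Suc l') r' = node_sum K l r l' r' - alt_sum K l r (Suc l') r' / real (Suc l')"
  using node_sum_Suc_left[of K l' r' l r] by (simp only: node_sum_commute alt_sum_commute)

lemma node_sum_Suc_right':
  "node_sum K l r l' r' = node_sum K l r l' (Suc r') - alt_sum K l r l' (Suc r') / real (Suc r')"
  using node_sum_Suc_right[of K l' r' l r] by (simp only: node_sum_commute alt_sum_commute)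

text \<open>Reflection changes the sign but, up to exchanging the pairs, not the widths. These are
  the starting points of the chains: four equal widths for the first case, the crossed form m, n, n,
  m for the second.\<close>

lemma node_sum_eq_0: "node_sum K m m n n = 0" "node_sum K m n n m = 0"
  using node_sum_reflect[of K m m n n] node_sum_reflect[of K m n n m]
    node_sum_commute[of K m n n m] by simp_all

section \<open>Closed form of the alternating Vandermonde sum\<close>

lemma coeff_one_minus_square_power:
  "coeff ([:1, 0, - 1::real:] ^ N) i = (if even i then (- 1) ^ (i div 2) * real (N choose (i div 2)) else 0)"
proof (induction N arbitrary: i)
  case 0
  then show ?case by (cases i) (auto elim!: evenE)
next
  case (Suc N)
  have "[:1, 0, - 1::real:] ^ Suc N = [:1, 0, - 1:] ^ N - pCons 0 (pCons 0 ([:1, 0, - 1:] ^ N))"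
    by (simp add: poly_eq_iff coeff_pCons split: nat.split)
  then have *: "coeff ([:1, 0, - 1::real:] ^ Suc N) i = coeff ([:1, 0, - 1:] ^ N) i
      - coeff (pCons 0 (pCons 0 ([:1, 0, - 1:] ^ N))) i"
    by (simp only: coeff_diff)
  consider "i = 0" | "i = 1" | j where "i = Suc (Suc j)"
    by (metis One_nat_def not0_implies_Suc)
  then show ?case
    unfolding * Suc.IH by cases (auto simp: Suc.IH algebra_simps)
qed

text \<open>Compare coefficients in (1-x)^(N+1) (1+x)^N = (1-x) (1-x^2)^N. Since (1-x^2)^N is even,
  each coefficient on the right comes from just one of the two terms of 1-x, so a single binomial
  remains.\<close>

lemma alternating_vandermonde:
  "(\<Sum>i\<le>k. (- 1) ^ i * real (Suc N choose i) * real (N choose (k - i)))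
    = (- 1) ^ (Suc k div 2) * real (N choose (k div 2))"
proof -
  have c: "coeff ([:1, b:] ^ n) i = real (n choose i) * b ^ i" for b :: real and n i
  proof (cases "i \<le> n")
    case False
    then have "degree ([:1, b:] ^ n) < i"
      using degree_power_le[of "[:1, b:]" n] by (simp split: if_splits)
    then show ?thesis using False by (simp add: coeff_eq_0)
  qed (simp add: coeff_linear_poly_power)
  have "[:1, - 1:] ^ Suc N * [:1, 1:] ^ N = [:1, - 1:] * ([:1, - 1:] * [:1, 1::real:]) ^ N"
    by (simp only: power_Suc power_mult_distrib mult.assoc)
  also have "[:1, - 1:] * [:1, 1:] = [:1, 0, - 1::real:]" by simp
  finally have "[:1, - 1:] ^ Suc N * [:1, 1:] ^ N = [:1, 0, - 1:] ^ N - pCons 0 ([:1, 0, - 1::real:] ^ N)"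
    by simp
  then have "coeff ([:1, - 1:] ^ Suc N * [:1, 1::real:] ^ N) k
      = coeff ([:1, 0, - 1:] ^ N) k - coeff (pCons 0 ([:1, 0, - 1:] ^ N)) k"
    by (simp only: coeff_diff)
  also have "\<dots> = (- 1) ^ (Suc k div 2) * real (N choose (k div 2))"
  proof (cases k)
    case (Suc j)
    then show ?thesis
      by (cases "even j") (auto simp: coeff_one_minus_square_power elim!: evenE oddE)
  qed (simp add: coeff_one_minus_square_power)
  finally show ?thesis
    unfolding coeff_mult c by (simp only: power_one mult_1_left mult_1_right mult_ac)
qed

lemma C_coeff_binomial:
  assumes "i \<le> m + n"
  shows "C_coeff m n (int i - int m) = fact m * fact n * real ((m + n) choose i) / fact (m + n)"
proof -
  have "nat (int m + (int i - int m)) = i" "nat (int n - (int i - int m)) = m + n - i"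
    using assms by linarith+
  then show ?thesis
    using assms by (simp add: C_coeff_def binomial_fact mult_ac)
qed

text \<open>Both factors are normalised binomial coefficients. The first vanishes below -l and the
  second above r'; shifting by l and reflecting the second makes the lower indices add up to l + r',
  a Vandermonde convolution.\<close>

lemma alt_sum_eq:
  assumes "l + r = Suc N" "l' + r' = N" "l \<le> K" "r' \<le> K"
  shows "alt_sum K l r l' r' = alt (int l) * (- 1) ^ (Suc (l + r') div 2) * real (N choose ((l + r') div 2))
    / (fact (Suc N) * fact N) * (fact l * fact r * fact l' * fact r')"
proof -
  let ?c = "(fact l * fact r * fact l' * fact r') / (fact (Suc N) * fact N) :: real"
  have "alt_sum K l r l' r' = (\<Sum>k\<in>{- int l..int r'}. alt k * C_coeff l r k * C_coeff l' r' k)"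
    unfolding alt_sum_def using assms(3,4)
    by (intro sum.mono_neutral_right) (auto simp: C_coeff_def)
  also have "\<dots> = (\<Sum>i\<le>l + r'. alt (int i - int l) * C_coeff l r (int i - int l) * C_coeff l' r' (int i - int l))"
    by (rule sum.reindex_bij_witness[of _ "\<lambda>i. int i - int l" "\<lambda>k. nat (k + int l)"]) auto
  also have "\<dots> = (\<Sum>i\<le>l + r'. alt (int l) * ?c *
      ((- 1) ^ i * real (Suc N choose i) * real (N choose (l + r' - i))))"
  proof (intro sum.cong refl)
    fix i assume i: "i \<in> {..l + r'}"
    \<comment> \<open>For i > N + 1 the coefficient and the binomial are both 0.\<close>
    have 1: "C_coeff l r (int i - int l) = fact l * fact r * real (Suc N choose i) / fact (Suc N)"
      using C_coeff_binomial[of i l r] assms(1)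
      by (cases "i \<le> Suc N") (auto simp: C_coeff_def simp del: fact_Suc)
    have "C_coeff l' r' (int i - int l) = C_coeff r' l' (int (l + r' - i) - int r')"
      using i C_coeff_minus[of r' l' "int i - int l"] by (simp add: of_nat_diff)
    also have "\<dots> = fact l' * fact r' * real (N choose (l + r' - i)) / fact N"
    proof (cases "l + r' - i \<le> N")
      case True
      then show ?thesis
        using C_coeff_binomial[of "l + r' - i" r' l'] assms(2) by (simp add: ac_simps)
    next
      case False
      then have "\<not> int (l + r' - i) - int r' \<le> int l'" using assms(2) by linarith
      then have "C_coeff r' l' (int (l + r' - i) - int r') = 0"
        by (simp only: C_coeff_def simp_thms if_False)
      then show ?thesis using False by (simp add: binomial_eq_0)
    qed
    finally have 2: "C_coeff l' r' (int i - int l) = fact l' * fact r' * real (N choose (l + r' - i)) / fact N" .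
    have 3: "alt (int i - int l) = alt (int l) * (- 1) ^ i"
      using alt_add[of "int i" "- int l"] by (simp add: alt_int)
    show "alt (int i - int l) * C_coeff l r (int i - int l) * C_coeff l' r' (int i - int l)
      = alt (int l) * ?c * ((- 1) ^ i * real (Suc N choose i) * real (N choose (l + r' - i)))"
      unfolding 1 2 3 by (simp only: mult_ac times_divide_eq_left times_divide_eq_right divide_divide_eq_left)
  qed
  also have "\<dots> = alt (int l) * ?c * ((- 1) ^ (Suc (l + r') div 2) * real (N choose ((l + r') div 2)))"
    unfolding sum_distrib_left[symmetric] alternating_vandermonde ..
  finally show ?thesis by (simp only: mult_ac times_divide_eq_left times_divide_eq_right)
qed

text \<open>The lower index is a separate parameter \<open>h\<close> so that it can be supplied in
  simplified form; sums with matching binomials then differ only in sign and factorials.\<close>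

lemma alt_sum_even:
  assumes "l + r = Suc N" "l' + r' = N" "l \<le> K" "r' \<le> K" and "even (l + Suc (l + r') div 2)"
    and "(l + r') div 2 = h"
  shows "alt_sum K l r l' r' = real (N choose h) / (fact (Suc N) * fact N)
    * (fact l * fact r * fact l' * fact r')"
proof -
  have "(- 1 :: real) ^ (l + Suc (l + r') div 2) = 1"
    using assms(5) by (rule neg_one_even_power)
  then have sgn: "alt (int l) * (- 1) ^ (Suc (l + r') div 2) = 1"
    by (simp only: alt_int power_add)
  show ?thesis
    unfolding alt_sum_eq[OF assms(1-4)] sgn assms(6) by simp
qed

lemma alt_sum_odd:
  assumes "l + r = Suc N" "l' + r' = N" "l \<le> K" "r' \<le> K" and "odd (l + Suc (l + r') div 2)"
    and "(l + r') div 2 = h"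
  shows "alt_sum K l r l' r' = - (real (N choose h) / (fact (Suc N) * fact N)
    * (fact l * fact r * fact l' * fact r'))"
proof -
  have "(- 1 :: real) ^ (l + Suc (l + r') div 2) = - 1"
    using assms(5) by (rule neg_one_odd_power)
  then have sgn: "alt (int l) * (- 1) ^ (Suc (l + r') div 2) = - 1"
    by (simp only: alt_int power_add)
  show ?thesis
    unfolding alt_sum_eq[OF assms(1-4)] sgn assms(6) by simp
qed

lemma alt_sum_nonneg:
  assumes "l + r = Suc N" "l' + r' = N" "l \<le> K" "r' \<le> K" and "even (l + Suc (l + r') div 2)"
  shows "alt_sum K l r l' r' \<ge> 0"
  unfolding alt_sum_even[OF assms refl] by simp

lemma alt_sum_nonpos:
  assumes "l + r = Suc N" "l' + r' = N" "l \<le> K" "r' \<le> K" and "odd (l + Suc (l + r') div 2)"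
  shows "alt_sum K l r l' r' \<le> 0"
  unfolding alt_sum_odd[OF assms refl] by simp

section \<open>Sign of the nodal sums, case by case\<close>

text \<open>From four widths m+1: raise l, lower r, raise l', lower r'. In this order the totals in
  each increment differ by one, and only two sums occur: p in the first two steps, q in the last
  two. The factorials give (m+1) q = -(m+2) p, so p + q \<le> 0.\<close>

lemma node_sum_nonneg_4_even:
  assumes "m + 4 \<le> K"
  shows "node_sum K (m + 2) m (m + 2) m \<ge> 0"
proof -
  define p q where "p = alt_sum K (m + 2) (m + 1) (m + 1) (m + 1)"
    and "q = alt_sum K (m + 2) (m + 1) (m + 2) m"
  have e: "even (m + 2 + Suc (m + 2 + (m + 1)) div 2)" "odd (m + 2 + Suc (m + 2 + m) div 2)"
    "(m + 2 + (m + 1)) div 2 = m + 1" "(m + 2 + m) div 2 = m + 1"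
    by presburger+
  have "p \<ge> 0"
    unfolding p_def by (rule alt_sum_nonneg[of _ _ "2 * m + 2"]) (use assms e in auto)
  have p: "p = real (2 * m + 2 choose (m + 1)) / (fact (Suc (2 * m + 2)) * fact (2 * m + 2))
    * (fact (m + 2) * fact (m + 1) * fact (m + 1) * fact (m + 1))"
    unfolding p_def by (rule alt_sum_even) (use assms e in auto)
  have q: "q = - (real (2 * m + 2 choose (m + 1)) / (fact (Suc (2 * m + 2)) * fact (2 * m + 2))
    * (fact (m + 2) * fact (m + 1) * fact (m + 2) * fact m))"
    unfolding q_def by (rule alt_sum_odd) (use assms e in auto)
  have "fact (m + 1) = real (m + 1) * fact m" "fact (m + 2) = real (m + 2) * fact (m + 1)"
    by (simp_all add: algebra_simps)
  then have "real (m + 1) * q = - real (m + 2) * p"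
    unfolding p q by (simp only: mult_ac mult_minus_right mult_minus_left)
  then have pq: "p + q = - p / real (m + 1)"
    by (simp add: field_simps)
  have "node_sum K (m + 2) (m + 1) (m + 1) (m + 1) = - p / real (m + 2)"
    using node_sum_Suc_left[of K "m + 1" "m + 1" "m + 1" "m + 1"]
    by (simp add: node_sum_eq_0 p_def)
  then have "node_sum K (m + 2) m (m + 1) (m + 1) = - p / real (m + 2) - p / real (m + 1)"
    using node_sum_Suc_right[of K "m + 2" m "m + 1" "m + 1"] by (simp add: p_def)
  then have "node_sum K (m + 2) m (m + 2) (m + 1) = - p / real (m + 2) - p / real (m + 1) - q / real (m + 2)"
    using node_sum_Suc_left'[of K "m + 2" m "m + 1" "m + 1"] alt_sum_commute[of K "m + 2" m]
    by (simp add: q_def)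
  then have "node_sum K (m + 2) m (m + 2) m
      = - p / real (m + 2) - p / real (m + 1) - q / real (m + 2) - q / real (m + 1)"
    using node_sum_Suc_right'[of K "m + 2" m "m + 2" m] alt_sum_commute[of K "m + 2" m]
    by (simp add: q_def)
  also have "\<dots> = - (p + q) * (1 / real (m + 2) + 1 / real (m + 1))"
    by (simp only: ring_distribs minus_add_distrib times_divide_eq_right mult_1_right)
      (simp add: diff_divide_distrib)
  also have "\<dots> \<ge> 0"
    unfolding pq using \<open>p \<ge> 0\<close> by simp
  finally show ?thesis .
qed

text \<open>One further step from difference 4, subtracting a nonpositive increment.\<close>

lemma node_sum_nonneg_5_even:
  assumes "m + 4 \<le> K"
  shows "node_sum K (m + 3) m (m + 2) m \<ge> 0"
proof -
  have "odd (m + 3 + Suc (m + 3 + m) div 2)" by presburger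
  then have "alt_sum K (m + 3) m (m + 2) m \<le> 0"
    by (intro alt_sum_nonpos[of _ _ "2 * m + 2"]) (use assms in auto)
  then have "alt_sum K (m + 3) m (m + 2) m / real (m + 3) \<le> 0"
    by (simp add: divide_nonpos_pos)
  then show ?thesis
    using node_sum_Suc_left[of K "m + 2" m "m + 2" m] node_sum_nonneg_4_even[OF assms]
    by (simp add: eval_nat_numeral)
qed

text \<open>Starts from the even case of difference 4 with m + 1 in place of m. Raising l and
  lowering r' subtract multiples of p \<le> 0. Raising l' then subtracts a positive term, but it
  exactly cancels the gain from lowering r'.\<close>

lemma node_sum_nonneg_67_odd:
  assumes "m + 5 \<le> K"
  shows "node_sum K (m + 4) (m + 1) (m + 3) m \<ge> 0" "node_sum K (m + 4) (m + 1) (m + 4) m \<ge> 0"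
proof -
  define a p q where "a = node_sum K (m + 3) (m + 1) (m + 3) (m + 1)"
    and "p = alt_sum K (m + 4) (m + 1) (m + 3) (m + 1)"
    and "q = alt_sum K (m + 4) (m + 1) (m + 4) m"
  have "a \<ge> 0"
    using node_sum_nonneg_4_even[of "m + 1" K] assms by (simp add: a_def eval_nat_numeral)
  have e: "odd (m + 4 + Suc (m + 4 + (m + 1)) div 2)" "even (m + 4 + Suc (m + 4 + m) div 2)"
    "(m + 4 + (m + 1)) div 2 = m + 2" "(m + 4 + m) div 2 = m + 2"
    by presburger+
  have "p \<le> 0"
    unfolding p_def by (rule alt_sum_nonpos[of _ _ "2 * m + 4"]) (use assms e in auto)
  have p: "p = - (real (2 * m + 4 choose (m + 2)) / (fact (Suc (2 * m + 4)) * fact (2 * m + 4))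
    * (fact (m + 4) * fact (m + 1) * fact (m + 3) * fact (m + 1)))"
    unfolding p_def by (rule alt_sum_odd) (use assms e in auto)
  have q: "q = real (2 * m + 4 choose (m + 2)) / (fact (Suc (2 * m + 4)) * fact (2 * m + 4))
    * (fact (m + 4) * fact (m + 1) * fact (m + 4) * fact m)"
    unfolding q_def by (rule alt_sum_even) (use assms e in auto)
  have "fact (m + 1) = real (m + 1) * fact m" by simp
  moreover have "fact (m + 4) = real (m + 4) * fact (m + 3)"
    using fact_Suc[of "m + 3"] by (simp add: eval_nat_numeral)
  ultimately have "real (m + 1) * q = - real (m + 4) * p"
    unfolding p q by (simp only: mult_ac mult_minus_right mult_minus_left minus_minus)
  then have q: "q / real (m + 4) = - p / real (m + 1)"
    by (simp add: field_simps)
  have "node_sum K (m + 4) (m + 1) (m + 3) (m + 1) = a - p / real (m + 4)"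
    using node_sum_Suc_left[of K "m + 3" "m + 1" "m + 3" "m + 1"]
    by (simp add: a_def p_def eval_nat_numeral)
  then have d6: "node_sum K (m + 4) (m + 1) (m + 3) m = a - p / real (m + 4) - p / real (m + 1)"
    using node_sum_Suc_right'[of K "m + 4" "m + 1" "m + 3" m] by (simp add: p_def)
  then have "node_sum K (m + 4) (m + 1) (m + 4) m
      = a - p / real (m + 4) - p / real (m + 1) - q / real (m + 4)"
    using node_sum_Suc_left'[of K "m + 4" "m + 1" "m + 3" m] by (simp add: q_def eval_nat_numeral)
  then have d7: "node_sum K (m + 4) (m + 1) (m + 4) m = a - p / real (m + 4)"
    unfolding q by simp
  have "p / real (m + 4) \<le> 0" "p / real (m + 1) \<le> 0"
    using \<open>p \<le> 0\<close> by (simp_all add: divide_nonpos_pos)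
  then show "node_sum K (m + 4) (m + 1) (m + 3) m \<ge> 0" "node_sum K (m + 4) (m + 1) (m + 4) m \<ge> 0"
    unfolding d6 d7 using \<open>a \<ge> 0\<close> by linarith+
qed

text \<open>From the crossed widths m+1, m+2, m+2, m+1: raise l, lower r, raise l again, then lower
  r' or r, with equal effect. The second result is not a stencil of the method, as there
  \<open>rp R \<le> rc R\<close>; it is an intermediate point for differences 6 and 7 with R
  even.\<close>

lemma node_sum_nonneg_4_odd:
  assumes "m + 4 \<le> K"
  shows "node_sum K (m + 3) (m + 1) (m + 2) m \<ge> 0" "node_sum K (m + 3) m (m + 2) (m + 1) \<ge> 0"
proof -
  define p q where "p = alt_sum K (m + 2) (m + 2) (m + 2) (m + 1)"
    and "q = alt_sum K (m + 3) (m + 1) (m + 2) (m + 1)"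
  have e: "even (m + 2 + Suc (m + 2 + (m + 1)) div 2)" "odd (m + 3 + Suc (m + 3 + (m + 1)) div 2)"
    "(m + 2 + (m + 1)) div 2 = m + 1" "(m + 3 + (m + 1)) div 2 = m + 2"
    by presburger+
  have "p \<ge> 0"
    unfolding p_def by (rule alt_sum_nonneg[of _ _ "2 * m + 3"]) (use assms e in auto)
  have p: "p = real (2 * m + 3 choose (m + 1)) / (fact (Suc (2 * m + 3)) * fact (2 * m + 3))
    * (fact (m + 2) * fact (m + 2) * fact (m + 2) * fact (m + 1))"
    unfolding p_def by (rule alt_sum_even) (use assms e in auto)
  have q: "q = - (real (2 * m + 3 choose (m + 2)) / (fact (Suc (2 * m + 3)) * fact (2 * m + 3))
    * (fact (m + 3) * fact (m + 1) * fact (m + 2) * fact (m + 1)))"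
    unfolding q_def by (rule alt_sum_odd) (use assms e in auto)
  have "2 * m + 3 choose (m + 2) = 2 * m + 3 choose (m + 1)"
    by (subst binomial_symmetric) auto
  moreover have "fact (m + 2) = real (m + 2) * fact (m + 1)" "fact (m + 3) = real (m + 3) * fact (m + 2)"
    using fact_Suc[of "m + 1"] fact_Suc[of "m + 2"] by (simp_all add: eval_nat_numeral)
  ultimately have "real (m + 2) * q = - real (m + 3) * p"
    unfolding p q by (simp only: mult_ac mult_minus_right mult_minus_left)
  then have q: "q = - (real (m + 3) / real (m + 2)) * p"
    by (simp add: field_simps)
  have "node_sum K (m + 2) (m + 2) (m + 2) (m + 1) = - p / real (m + 2)"
    using node_sum_Suc_left[of K "m + 1" "m + 2" "m + 2" "m + 1"]
    by (simp add: node_sum_eq_0 p_def)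
  then have "node_sum K (m + 2) (m + 1) (m + 2) (m + 1) = - 2 * p / real (m + 2)"
    using node_sum_Suc_right[of K "m + 2" "m + 1" "m + 2" "m + 1"] by (simp add: p_def)
  then have *: "node_sum K (m + 3) (m + 1) (m + 2) (m + 1) = - 2 * p / real (m + 2) - q / real (m + 3)"
    using node_sum_Suc_left[of K "m + 2" "m + 1" "m + 2" "m + 1"] by (simp add: q_def eval_nat_numeral)
  have **: "- 2 * p / real (m + 2) - q / real (m + 3) - q / real (m + 1)
      = 2 * p / (real (m + 1) * real (m + 2))"
    unfolding q by (simp add: divide_simps) (simp add: algebra_simps)
  have "node_sum K (m + 3) (m + 1) (m + 2) m = 2 * p / (real (m + 1) * real (m + 2))"
    using * ** node_sum_Suc_right'[of K "m + 3" "m + 1" "m + 2" m] by (simp add: q_def)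
  moreover have "node_sum K (m + 3) m (m + 2) (m + 1) = 2 * p / (real (m + 1) * real (m + 2))"
    using * ** node_sum_Suc_right[of K "m + 3" m "m + 2" "m + 1"] by (simp add: q_def)
  ultimately show "node_sum K (m + 3) (m + 1) (m + 2) m \<ge> 0" "node_sum K (m + 3) m (m + 2) (m + 1) \<ge> 0"
    using \<open>p \<ge> 0\<close> by simp_all
qed

text \<open>Going from difference 5 to 6 with R even by raising l' would involve a sum with equal
  totals, outside \<open>alt_sum_eq\<close>; the detour through \<open>a\<close> avoids it. For
  difference 7 the positive q again cancels the gain from lowering r'.\<close>

lemma node_sum_nonneg_567:
  assumes "m + 4 \<le> K"
  shows "node_sum K (m + 3) (m + 1) (m + 3) m \<ge> 0" "node_sum K (m + 3) m (m + 3) m \<ge> 0"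
    "node_sum K (m + 4) m (m + 3) m \<ge> 0"
proof -
  define a p q where "a = node_sum K (m + 3) m (m + 2) (m + 1)"
    and "p = alt_sum K (m + 3) (m + 1) (m + 3) m"
    and "q = alt_sum K (m + 4) m (m + 3) m"
  have "a \<ge> 0"
    unfolding a_def by (rule node_sum_nonneg_4_odd[OF assms])
  have e: "odd (m + 3 + Suc (m + 3 + m) div 2)" "even (m + 4 + Suc (m + 4 + m) div 2)"
    "(m + 3 + m) div 2 = m + 1" "(m + 4 + m) div 2 = m + 2"
    by presburger+
  have "p \<le> 0"
    unfolding p_def by (rule alt_sum_nonpos[of _ _ "2 * m + 3"]) (use assms e in auto)
  have p: "p = - (real (2 * m + 3 choose (m + 1)) / (fact (Suc (2 * m + 3)) * fact (2 * m + 3))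
    * (fact (m + 3) * fact (m + 1) * fact (m + 3) * fact m))"
    unfolding p_def by (rule alt_sum_odd) (use assms e in auto)
  have q: "q = real (2 * m + 3 choose (m + 2)) / (fact (Suc (2 * m + 3)) * fact (2 * m + 3))
    * (fact (m + 4) * fact m * fact (m + 3) * fact m)"
    unfolding q_def by (rule alt_sum_even) (use assms e in auto)
  have "2 * m + 3 choose (m + 2) = 2 * m + 3 choose (m + 1)"
    by (subst binomial_symmetric) auto
  moreover have "fact (m + 1) = real (m + 1) * fact m" "fact (m + 4) = real (m + 4) * fact (m + 3)"
    using fact_Suc[of m] fact_Suc[of "m + 3"] by (simp_all add: eval_nat_numeral)
  ultimately have "real (m + 1) * q = - real (m + 4) * p"
    unfolding p q by (simp only: mult_ac mult_minus_right mult_minus_left minus_minus)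
  then have q: "q / real (m + 4) = - p / real (m + 1)"
    by (simp add: field_simps)
  have "node_sum K (m + 3) m (m + 3) (m + 1) = a - p / real (m + 3)"
    using node_sum_Suc_left'[of K "m + 3" m "m + 2" "m + 1"] alt_sum_commute[of K "m + 3" m]
    by (simp add: a_def p_def eval_nat_numeral)
  then have d6: "node_sum K (m + 3) m (m + 3) m = a - p / real (m + 3) - p / real (m + 1)"
    using node_sum_Suc_right'[of K "m + 3" m "m + 3" m] alt_sum_commute[of K "m + 3" m]
    by (simp add: p_def)
  then have "node_sum K (m + 4) m (m + 3) m
      = a - p / real (m + 3) - p / real (m + 1) - q / real (m + 4)"
    using node_sum_Suc_left[of K "m + 3" m "m + 3" m] by (simp add: q_def eval_nat_numeral)
  then have d7: "node_sum K (m + 4) m (m + 3) m = a - p / real (m + 3)"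
    unfolding q by simp
  have d5: "node_sum K (m + 3) (m + 1) (m + 3) m
      = node_sum K (m + 3) (m + 1) (m + 2) m - p / real (m + 3)"
    using node_sum_Suc_left'[of K "m + 3" "m + 1" "m + 2" m] by (simp add: p_def eval_nat_numeral)
  have "p / real (m + 3) \<le> 0" "p / real (m + 1) \<le> 0"
    using \<open>p \<le> 0\<close> by (simp_all add: divide_nonpos_pos)
  then show "node_sum K (m + 3) (m + 1) (m + 3) m \<ge> 0" "node_sum K (m + 3) m (m + 3) m \<ge> 0"
    "node_sum K (m + 4) m (m + 3) m \<ge> 0"
    unfolding d5 d6 d7 using \<open>a \<ge> 0\<close> node_sum_nonneg_4_odd(1)[OF assms] by linarith+
qed

lemma node_sum_nonneg:
  assumes "4 \<le> int L - int R" "int L - int R \<le> 7" and "L + R \<le> K"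
  shows "node_sum K (lc L) (rc R) (lp L) (rp R) \<ge> 0"
proof -
  define d where "d = L - R"
  have L: "L = R + d" and d: "d = 4 \<or> d = 5 \<or> d = 6 \<or> d = 7"
    using assms(1,2) unfolding d_def by linarith+
  define m where "m = R div 2"
  have K: "m + 4 \<le> K"
    using assms(3) L d unfolding m_def by linarith
  have rp: "rp R = m" by (simp add: rp_def m_def)
  show ?thesis
  proof (cases "even R")
    case True
    then have R: "R = 2 * m" by (simp add: m_def)
    have rc: "rc R = m" unfolding rc_def rp by (simp add: R)
    consider "d = 4" "lc L = m + 2" "lp L = m + 2" | "d = 5" "lc L = m + 3" "lp L = m + 2"
      | "d = 6" "lc L = m + 3" "lp L = m + 3" | "d = 7" "lc L = m + 4" "lp L = m + 3"
      using d by (auto simp: lc_def lp_def L R)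
    then show ?thesis
      unfolding rp rc using node_sum_nonneg_4_even[OF K] node_sum_nonneg_5_even[OF K]
        node_sum_nonneg_567(2,3)[OF K] by cases simp_all
  next
    case False
    then have R: "R = 2 * m + 1" by (simp add: m_def)
    have rc: "rc R = m + 1" unfolding rc_def rp by (simp add: R)
    have K5: "m + 5 \<le> K"
      using assms(3) L d R by linarith
    consider "d = 4" "lc L = m + 3" "lp L = m + 2" | "d = 5" "lc L = m + 3" "lp L = m + 3"
      | "d = 6" "lc L = m + 4" "lp L = m + 3" | "d = 7" "lc L = m + 4" "lp L = m + 4"
      using d by (auto simp: lc_def lp_def L R)
    then show ?thesis
      unfolding rp rc using node_sum_nonneg_4_odd(1)[OF K] node_sum_nonneg_567(1)[OF K]
        node_sum_nonneg_67_odd[OF K5] by cases simp_all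
  qed
qed

subsection \<open>Instability\<close>

lemma exp_i_int_pi: "exp (\<i> * of_int k * complex_of_real pi) = complex_of_real (alt k)"
proof -
  have "exp (\<i> * of_int k * complex_of_real pi) = cis (pi * of_int k)"
    by (simp only: cis_conv_exp of_real_mult of_real_of_int_eq mult_ac)
  also have "\<dots> = complex_of_real (alt k)"
    by (simp add: complex_eq_iff alt_def)
  finally show ?thesis .
qed

lemma symbol_H_pi:
  assumes "optimal_DDO L R \<alpha> \<beta>"
  shows "symbol_H L R \<beta> pi
    = complex_of_real (- 2 * node_sum (L + R) (lc L) (rc R) (lp L) (rp R))"
proof -
  let ?C = "\<lambda>k. C_coeff (lc L) (rc R) k * C_coeff (lp L) (rp R) k"
  let ?I = "node_stencil L R"
  have "(\<Sum>k\<in>?I. \<beta> k * alt k) = \<beta> 0 + (\<Sum>k\<in>?I - {0}. \<beta> k * alt k)"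
    by (subst sum.remove[of _ 0]) (auto simp: node_stencil_def)
  also have "(\<Sum>k\<in>?I - {0}. \<beta> k * alt k)
      = (\<Sum>k\<in>?I - {0}. - 2 * (alt k * C_coeff (lc L) (rc R) k * C_coeff (lp L) (rp R) k / of_int k))"
    by (intro sum.cong refl) (simp add: optimal_DDO_node_coeff[OF assms])
  \<comment> \<open>The second coefficient vanishes outside the node stencil, so the range may grow
    to that of \<open>node_sum\<close>.\<close>
  also have "\<dots> = (\<Sum>k\<in>{- int (L + R)..int (L + R)} - {0}.
      - 2 * (alt k * C_coeff (lc L) (rc R) k * C_coeff (lp L) (rp R) k / of_int k))"
    by (rule sum.mono_neutral_left)
      (auto simp: node_stencil_def C_coeff_def lp_def rp_def)
  finally have "(\<Sum>k\<in>?I. \<beta> k * alt k) = - 2 * node_sum (L + R) (lc L) (rc R) (lp L) (rp R)"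
    unfolding optimal_DDO_node_coeff_0[OF assms] sum_distrib_left[symmetric] node_sum_def
    by (simp add: algebra_simps)
  moreover have "symbol_H L R \<beta> pi = complex_of_real (\<Sum>k\<in>?I. \<beta> k * alt k)"
    by (simp add: symbol_H_def exp_i_int_pi)
  ultimately show ?thesis by simp
qed

text \<open>Both roots given by the quadratic formula belong to the spectrum. They add up to the
  nodal symbol, so they cannot both have positive real part.\<close>

lemma not_HV_stableI:
  assumes "0 < \<theta>" "\<theta> < 2 * pi" and "Re (symbol_H L R \<beta> \<theta>) \<le> 0"
  shows "\<not> HV_stable L R \<alpha> \<beta>"
proof
  assume stable: "HV_stable L R \<alpha> \<beta>"
  define b c D where "b = symbol_H L R \<beta> \<theta>" and "c = symbol_F L R \<alpha> \<theta>"
    and "D = csqrt (b\<^sup>2 + 4 * c)"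
  have D: "D\<^sup>2 = b\<^sup>2 + 4 * c" by (simp add: D_def)
  have "((b + D) / 2)\<^sup>2 - b * ((b + D) / 2) - c = (D\<^sup>2 - (b\<^sup>2 + 4 * c)) / 4"
    "((b - D) / 2)\<^sup>2 - b * ((b - D) / 2) - c = (D\<^sup>2 - (b\<^sup>2 + 4 * c)) / 4"
    by (simp_all add: power2_eq_square field_simps)
  then have "((b + D) / 2)\<^sup>2 - b * ((b + D) / 2) - c = 0" "((b - D) / 2)\<^sup>2 - b * ((b - D) / 2) - c = 0"
    unfolding D by simp_all
  then have "(b + D) / 2 \<in> HV_spectrum L R \<alpha> \<beta>" "(b - D) / 2 \<in> HV_spectrum L R \<alpha> \<beta>"
    using assms(1,2) by (auto simp: HV_spectrum_def b_def c_def)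
  then have "Re ((b + D) / 2) > 0" "Re ((b - D) / 2) > 0"
    using stable by (auto simp: HV_stable_def)
  then show False using assms(3) by (simp add: b_def)
qed

theorem theorem3p2:
  fixes L R :: nat and \<alpha> \<beta> :: "int \<Rightarrow> real"
  assumes "4 \<le> int L - int R" and "int L - int R \<le> 7"
    and "optimal_DDO L R \<alpha> \<beta>"
  shows "\<not> HV_stable L R \<alpha> \<beta>"
proof (rule not_HV_stableI)
  show "Re (symbol_H L R \<beta> pi) \<le> 0"
    unfolding symbol_H_pi[OF assms(3)] using node_sum_nonneg[OF assms(1,2) order_refl] by simp
qed (use pi_gt_zero in linarith)+

end
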